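(* Let $F$ be a finite field with $|F|=q$ and $\operatorname{char}(F)=p\neq 2$, and let $\star$ be the involution on the algebra $UT_2(F)$ of $2\times 2$ upper triangular matrices given by $$\begin{pmatrix} a&c\\0&b\end{pmatrix}^{\star}=\begin{pmatrix} b&c\\0&a\end{pmatrix}\qquad (a,b,c\in F).$$ Then $$C(UT_2(F),\star)=\left\langle\, l\,y_1\,(y_2^{q+l-1}-y_2^l)+y_1^q y_2^l \;:\; 1\le l\le p\,\right\rangle^{TS( * )}+\langle z_1z_2\rangle^{TS( * )}+Id(UT_2(F),\star).$$
   Context: All algebras are unitary and associative over $F$. Let $X=\{x_1,x_2,\ldots\}$ and $X^*=\{x_1^*,x_2^*,\ldots\}$ be disjoint infinite sets, and let $F\langle X\cup X^*\rangle$ be the free unitary associative $F$-algebra freely generated by $X\cup X^*$, with the $F$-linear involution $*$ determined by $x_i\leftrightarrow x_i^*$. Put $y_i=x_i+x_i^*$, $z_i=x_i-x_i^*$, $Y=\{y_1,y_2,\ldots\}$, $Z=\{z_1,z_2,\ldots\}$. Then $F\langle X\cup X^*\rangle=F\langle Y\cup Z\rangle$ is free on $Y\cup Z$, with $y_i^*=y_i$ and $z_i^*=-z_i$. For an algebra $A$ with involution $\circledast$, put $A^+=\{a\in A: a^\circledast=a\}$, $A^-=\{a\in A:a^\circledast=-a\}$. A polynomial $f(y_1,\ldots,y_n,z_1,\ldots,z_m)$ belongs to $Id(A,\circledast)$ (is a $*$-polynomial identity) if $f(a_1,\ldots,a_n,b_1,\ldots,b_m)=0$ for all $a_i\in A^+$,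 $b_j\in A^-$; it belongs to $C(A,\circledast)$ (is a $*$-central polynomial) if $f(a_1,\ldots,a_n,b_1,\ldots,b_m)\in Z(A)$, the center of $A$, for all $a_i\in A^+$, $b_j\in A^-$. A $*$-endomorphism of $F\langle Y\cup Z\rangle$ is a (unital) algebra endomorphism commuting with $*$. A $T( * )$-space is a vector subspace of $F\langle Y\cup Z\rangle$ closed under all $*$-endomorphisms; $\langle W\rangle^{TS( * )}$ is the smallest $T( * )$-space containing $W$. Equivalently it is spanned by all $f(g_1,\ldots,g_n,h_1,\ldots,h_m)$ with $f(y_1,\ldots,y_n,z_1,\ldots,z_m)\in W$, $g_i\in F\langle Y\cup Z\rangle^+$, $h_j\in F\langle Y\cup Z\rangle^-$. The sign $+$ between subspaces denotes the sum of vector subspaces. The integer coefficient $l$ is interpreted in $F$. *)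

theory Defs
  imports
    "HOL-Analysis.Analysis"
    "HOL-Library.Poly_Mapping"
    "HOL-Library.Set_Algebras"
begin

section \<open>Algebras with involution\<close>

locale assoc_algebra = vector_space scale
  for scale :: "'f::field \<Rightarrow> 'a::ring_1 \<Rightarrow> 'a" +
  assumes scale_mult_left: "scale c a * b = scale c (a * b)"
    and scale_mult_right: "a * scale c b = scale c (a * b)"

locale star_algebra = assoc_algebra scale
  for scale :: "'f::field \<Rightarrow> 'a::ring_1 \<Rightarrow> 'a" +
  fixes invol :: "'a \<Rightarrow> 'a"
  assumes invol_add: "invol (a + b) = invol a + invol b"
    and invol_scale: "invol (scale c a) = scale c (invol a)"
    and invol_mult: "invol (a * b) = invol b * invol a"
    and invol_invol: "invol (invol a) = a"

definition alg_hom ::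
  "('f::field \<Rightarrow> 'a::ring_1 \<Rightarrow> 'a) \<Rightarrow> ('f \<Rightarrow> 'b::ring_1 \<Rightarrow> 'b) \<Rightarrow> ('a \<Rightarrow> 'b) \<Rightarrow> bool" where
  "alg_hom s t \<phi> \<longleftrightarrow>
     Vector_Spaces.linear s t \<phi> \<and> \<phi> 1 = 1 \<and> (\<forall>a b. \<phi> (a * b) = \<phi> a * \<phi> b)"

definition symmetric_elems :: "('a \<Rightarrow> 'a) \<Rightarrow> 'a set" where
  "symmetric_elems invol = {a. invol a = a}"

definition skew_elems :: "('a::uminus \<Rightarrow> 'a) \<Rightarrow> 'a set" where
  "skew_elems invol = {a. invol a = - a}"

definition alg_center :: "'a::ring_1 set" where
  "alg_center = {c. \<forall>a. c * a = a * c}"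


section \<open>The free algebra with involution\<close>

text \<open>
  Words over a set of letters form the free monoid, written additively so that
  finitely supported functions on it, with the convolution product, are the free algebra.
\<close>

datatype 'x fword = Word (letters: "'x list")

instantiation fword :: (type) monoid_add
begin

definition "0 = Word []"
definition "v + w = Word (letters v @ letters w)"

instance
  by standard (simp_all add: zero_fword_def plus_fword_def)

end

text \<open>\<open>Var i\<close> stands for \<open>x\<^sub>i\<close> and \<open>VarStar i\<close> for \<open>x\<^sub>i\<^sup>*\<close>.\<close>

datatype letter = Var nat | VarStar nat

type_synonym 'f free_alg = "letter fword \<Rightarrow>\<^sub>0 'f"

definition free_scale :: "'f::field \<Rightarrow> 'f free_alg \<Rightarrow> 'f free_alg" where
  "free_scale c f = Poly_Mapping.map ((*) c) f"

fun swap_letter :: "letter \<Rightarrow> letter" where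
  "swap_letter (Var i) = VarStar i"
| "swap_letter (VarStar i) = Var i"

definition star_word :: "letter fword \<Rightarrow> letter fword" where
  "star_word w = Word (rev (map swap_letter (letters w)))"

text \<open>As \<open>star_word\<close> is its own inverse, reindexing along it sends each word \<open>w\<close> to \<open>star_word w\<close>.\<close>

definition free_star :: "'f::field free_alg \<Rightarrow> 'f free_alg" where
  "free_star f = Poly_Mapping.map_key star_word f"

definition gen_x :: "nat \<Rightarrow> 'f::field free_alg" where
  "gen_x i = Poly_Mapping.single (Word [Var i]) 1"

definition gen_y :: "nat \<Rightarrow> 'f::field free_alg" where
  "gen_y i = gen_x i + free_star (gen_x i)"

definition gen_z :: "nat \<Rightarrow> 'f::field free_alg" where
  "gen_z i = gen_x i - free_star (gen_x i)"


lemma star_word_star_word [simp]: "star_word (star_word w) = w"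
proof -
  have "swap_letter (swap_letter l) = l" for l by (cases l) auto
  then show ?thesis by (cases w) (simp add: star_word_def rev_map comp_def)
qed

lemma inj_star_word: "inj star_word"
  by (metis injI star_word_star_word)

lemma star_word_add: "star_word (v + w) = star_word w + star_word v"
  by (simp add: star_word_def plus_fword_def)

lemma free_scale_eq: "free_scale c f = Poly_Mapping.single 0 c * f"
  by (simp add: free_scale_def mult_map_scale_conv_mult)

lemma free_scale_single: "free_scale c (Poly_Mapping.single w d) = Poly_Mapping.single w (c * d)"
  by (simp add: free_scale_eq mult_single)

lemma free_alg_induct [case_names zero add]:
  fixes f :: "'f::field free_alg"
  assumes "P 0" and "\<And>f w c. P f \<Longrightarrow> P (f + Poly_Mapping.single w c)"
  shows "P f"
proof (induction f rule: update_induct)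
  case const
  then show ?case by (rule assms(1))
next
  case (update f w c)
  have "Poly_Mapping.update w c f = f + Poly_Mapping.single w c"
    using update(1)
    by (intro poly_mapping_eqI)
       (auto simp: lookup_add lookup_single lookup_update when_def in_keys_iff)
  then show ?case using assms(2) update by simp
qed

lemma free_star_add: "free_star (f + g) = free_star f + free_star g"
  by (simp add: free_star_def map_key_plus[OF inj_star_word])

lemma free_star_zero [simp]: "free_star 0 = 0"
  by (simp add: free_star_def map_key_zero[OF inj_star_word])

lemma free_star_single: "free_star (Poly_Mapping.single w c) = Poly_Mapping.single (star_word w) c"
  unfolding free_star_def using map_key_single[OF inj_star_word, of "star_word w" c] by simp

lemma assoc_algebra_free: "assoc_algebra (free_scale :: 'f::field \<Rightarrow> _)"
proof
  fix c d :: 'f and a b :: "'f free_alg"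
  show "free_scale c (a + b) = free_scale c a + free_scale c b"
    by (simp add: free_scale_eq distrib_left)
  show "free_scale (c + d) a = free_scale c a + free_scale d a"
    by (simp add: free_scale_eq single_add distrib_right)
  show "free_scale c (free_scale d a) = free_scale (c * d) a"
    by (simp add: free_scale_eq mult_single flip: mult.assoc)
  show "free_scale 1 a = a"
    by (simp add: free_scale_eq)
  show "free_scale c a * b = free_scale c (a * b)"
    by (simp add: free_scale_eq mult.assoc)
  have "a * Poly_Mapping.single 0 c = Poly_Mapping.single 0 c * a"
    by (induction a rule: free_alg_induct)
       (simp_all add: distrib_left distrib_right mult_single mult.commute)
  then show "a * free_scale c b = free_scale c (a * b)"
    by (simp add: free_scale_eq flip: mult.assoc)
qed

lemma star_algebra_free: "star_algebra (free_scale :: 'f::field \<Rightarrow> _) free_star"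
proof (intro star_algebra.intro assoc_algebra_free star_algebra_axioms.intro)
  fix c :: 'f and a b :: "'f free_alg"
  show "free_star (a + b) = free_star a + free_star b"
    by (rule free_star_add)
  have single: "free_star (Poly_Mapping.single w d * b) = free_star b * free_star (Poly_Mapping.single w d)" for w d
    by (induction b rule: free_alg_induct)
       (simp_all add: distrib_left distrib_right free_star_add mult_single free_star_single
          star_word_add mult.commute)
  show mult: "free_star (a * b) = free_star b * free_star a"
    by (induction a rule: free_alg_induct)
       (simp_all add: distrib_left distrib_right free_star_add single)
  show "free_star (free_scale c a) = free_scale c (free_star a)"
    by (induction a rule: free_alg_induct)
       (simp_all add: free_scale_eq distrib_left free_star_add mult_single free_star_single)
  show "free_star (free_star a) = a"
    by (induction a rule: free_alg_induct)
       (simp_all add: free_star_add free_star_single)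
qed

lemma free_star_gen_x: "free_star (gen_x i) = Poly_Mapping.single (Word [VarStar i]) 1"
  by (simp add: gen_x_def free_star_single star_word_def)

lemma free_star_gen_y: "free_star (gen_y i) = gen_y i"
  by (simp add: gen_y_def free_star_add star_algebra.invol_invol[OF star_algebra_free] add.commute)

lemma free_star_gen_z: "free_star (gen_z i) = - gen_z i"
proof -
  have "free_star (gen_z i) + free_star (free_star (gen_x i)) = free_star (gen_x i)"
    by (simp add: gen_z_def flip: free_star_add)
  then show ?thesis
    by (simp add: gen_z_def star_algebra.invol_invol[OF star_algebra_free] eq_diff_eq)
qed

lemma free_on_letters:
  fixes scale :: "'f::field \<Rightarrow> 'a::ring_1 \<Rightarrow> 'a"
  assumes "assoc_algebra scale"
  shows "\<exists>!\<phi>. alg_hom free_scale scale \<phi> \<and>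
           (\<forall>l. \<phi> (Poly_Mapping.single (Word [l]) 1) = g l)"
proof
  interpret assoc_algebra scale by fact
  interpret F: assoc_algebra "free_scale :: 'f \<Rightarrow> _" by (rule assoc_algebra_free)
  define m where "m w = prod_list (map g (letters w))" for w
  define \<phi> where "\<phi> f = (\<Sum>w\<in>Poly_Mapping.keys f. scale (Poly_Mapping.lookup f w) (m w))" for f
  have m0: "m 0 = 1" and madd: "m (v + w) = m v * m w" for v w
    by (simp_all add: m_def zero_fword_def plus_fword_def)
  have add: "\<phi> (f + g) = \<phi> f + \<phi> g" for f g
    unfolding \<phi>_def by (rule setsum_keys_plus_distrib) (simp_all add: scale_left_distrib)
  have single: "\<phi> (Poly_Mapping.single w c) = scale c (m w)" for w c
    by (simp add: \<phi>_def)
  have zero: "\<phi> 0 = 0" by (simp add: \<phi>_def)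
  have sm: "\<phi> (Poly_Mapping.single w c * f) = \<phi> (Poly_Mapping.single w c) * \<phi> f" for w c f
    by (induction f rule: free_alg_induct)
       (simp_all add: zero add distrib_left mult_single single madd scale_mult_left scale_mult_right)
  have mult: "\<phi> (f * g) = \<phi> f * \<phi> g" for f g
    by (induction f rule: free_alg_induct) (simp_all add: zero add distrib_right sm)
  have one: "\<phi> 1 = 1"
    using single[of 0 1] by (simp add: m0)
  have "\<phi> (free_scale c f) = scale c (\<phi> f)" for c f
    using mult[of "Poly_Mapping.single 0 c" f]
    by (simp add: free_scale_eq single m0 scale_mult_left)
  then have "Vector_Spaces.linear free_scale scale \<phi>"
    by unfold_locales (simp_all add: add)
  with one mult show "alg_hom free_scale scale \<phi> \<and>
           (\<forall>l. \<phi> (Poly_Mapping.single (Word [l]) 1) = g l)"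
    by (simp add: alg_hom_def single m_def)
  fix \<psi> :: "'f free_alg \<Rightarrow> 'a"
  assume \<psi>: "alg_hom free_scale scale \<psi> \<and> (\<forall>l. \<psi> (Poly_Mapping.single (Word [l]) 1) = g l)"
  then interpret \<psi>: Vector_Spaces.linear free_scale scale \<psi> by (simp add: alg_hom_def)
  have word: "\<psi> (Poly_Mapping.single (Word ls) 1) = m (Word ls)" for ls
  proof (induction ls)
    case Nil
    then show ?case using \<psi> by (simp add: alg_hom_def m0 flip: zero_fword_def)
  next
    case (Cons l ls)
    have "(Poly_Mapping.single (Word (l # ls)) 1 :: 'f free_alg) =
        Poly_Mapping.single (Word [l]) 1 * Poly_Mapping.single (Word ls) 1"
      by (simp add: mult_single plus_fword_def)
    with Cons \<psi> show ?case by (simp add: alg_hom_def m_def)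
  qed
  show "\<psi> = \<phi>"
  proof
    fix f
    show "\<psi> f = \<phi> f"
    proof (induction f rule: free_alg_induct)
      case zero
      show ?case by (simp add: \<open>\<phi> 0 = 0\<close>)
    next
      case (add f w c)
      have "Poly_Mapping.single w c = free_scale c (Poly_Mapping.single w 1)"
        by (simp add: free_scale_single)
      then have "\<psi> (Poly_Mapping.single w c) = scale c (m w)"
        using word[of "letters w"] by (simp add: \<psi>.scale)
      with add show ?case by (simp add: \<psi>.add \<open>\<And>f g. \<phi> (f + g) = \<phi> f + \<phi> g\<close> single)
    qed
  qed
qed

lemma two_neq_zero:
  assumes "CHAR('f::field) \<noteq> 2"
  shows "(2::'f) \<noteq> 0"
proof
  assume "(2::'f) = 0"
  then have "CHAR('f) dvd 2"
    by (metis of_nat_eq_0_iff_char_dvd of_nat_numeral)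
  then have "CHAR('f) = 1 \<or> CHAR('f) = 2"
    using two_is_prime_nat by (auto simp: prime_nat_iff)
  with assms show False
    using of_nat_CHAR[where 'a = 'f] by auto
qed

lemma free_on_y_z:
  fixes scale :: "'f::field \<Rightarrow> 'a::ring_1 \<Rightarrow> 'a"
  assumes "assoc_algebra scale" and char: "CHAR('f) \<noteq> 2"
  shows "\<exists>!\<phi>. alg_hom free_scale scale \<phi> \<and> (\<forall>i. \<phi> (gen_y i) = a i) \<and> (\<forall>i. \<phi> (gen_z i) = b i)"
proof -
  interpret assoc_algebra scale by fact
  have half: "scale (1/2) u + scale (1/2) u = u" for u
    using two_neq_zero[OF char] by (simp flip: scale_left_distrib)
  define g where "g l = (case l of Var i \<Rightarrow> scale (1/2) (a i + b i)
    | VarStar i \<Rightarrow> scale (1/2) (a i - b i))" for l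
  have iff: "(\<forall>i. \<phi> (gen_y i) = a i) \<and> (\<forall>i. \<phi> (gen_z i) = b i) \<longleftrightarrow>
      (\<forall>l. \<phi> (Poly_Mapping.single (Word [l]) 1) = g l)" (is "?L \<longleftrightarrow> ?R")
    if "alg_hom free_scale scale \<phi>" for \<phi>
  proof -
    interpret \<phi>: Vector_Spaces.linear free_scale scale \<phi>
      using that by (simp add: alg_hom_def)
    have yz: "\<phi> (gen_y i) = \<phi> (Poly_Mapping.single (Word [Var i]) 1)
        + \<phi> (Poly_Mapping.single (Word [VarStar i]) 1)"
      "\<phi> (gen_z i) = \<phi> (Poly_Mapping.single (Word [Var i]) 1)
        - \<phi> (Poly_Mapping.single (Word [VarStar i]) 1)" for i
      unfolding gen_y_def gen_z_def free_star_gen_x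
      by (simp_all add: \<phi>.add \<phi>.diff gen_x_def)
    show ?thesis
    proof
      assume ?R
      then show ?L
        by (simp add: yz g_def half flip: scale_right_distrib scale_right_diff_distrib)
           (simp add: scale_right_distrib half)
    next
      assume L: ?L
      show ?R
      proof
        fix l
        show "\<phi> (Poly_Mapping.single (Word [l]) 1) = g l"
        proof (cases l)
          case (Var i)
          let ?u = "\<phi> (Poly_Mapping.single (Word [Var i]) 1)"
          have "a i + b i = ?u + ?u" using L yz[of i] by (simp add: algebra_simps)
          then show ?thesis by (simp add: g_def Var scale_right_distrib half)
        next
          case (VarStar i)
          let ?u = "\<phi> (Poly_Mapping.single (Word [VarStar i]) 1)"
          have "a i - b i = ?u + ?u" using L yz[of i] by (simp add: algebra_simps)
          then show ?thesis by (simp add: g_def VarStar scale_right_distrib half)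
        qed
      qed
    qed
  qed
  from free_on_letters[OF assms(1), of g] show ?thesis
    using iff by (smt (verit) Ex1_def)
qed


section \<open>Identities, central polynomials and T(*)-spaces\<close>

text \<open>
  In characteristic different from 2 the free algebra is freely generated by the
  \<open>y i\<close> and \<open>z i\<close> (lemma \<open>free_on_y_z\<close> below), so evaluating
  \<open>f(y\<^sub>1,\<dots>,y\<^sub>n,z\<^sub>1,\<dots>,z\<^sub>m)\<close> at \<open>a\<^sub>i\<close>, \<open>b\<^sub>j\<close> means applying the
  algebra homomorphism with \<open>y i \<mapsto> a\<^sub>i\<close> and \<open>z j \<mapsto> b\<^sub>j\<close>.
\<close>

definition evaluation ::
  "('f::field \<Rightarrow> 'a::ring_1 \<Rightarrow> 'a) \<Rightarrow> ('a \<Rightarrow> 'a) \<Rightarrow> ('f free_alg \<Rightarrow> 'a) \<Rightarrow> bool" where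
  "evaluation s invol \<phi> \<longleftrightarrow> alg_hom free_scale s \<phi> \<and>
     (\<forall>i. \<phi> (gen_y i) \<in> symmetric_elems invol) \<and> (\<forall>i. \<phi> (gen_z i) \<in> skew_elems invol)"

definition star_Id ::
  "('f::field \<Rightarrow> 'a::ring_1 \<Rightarrow> 'a) \<Rightarrow> ('a \<Rightarrow> 'a) \<Rightarrow> 'f free_alg set" where
  "star_Id s invol = {f. \<forall>\<phi>. evaluation s invol \<phi> \<longrightarrow> \<phi> f = 0}"

definition star_C ::
  "('f::field \<Rightarrow> 'a::ring_1 \<Rightarrow> 'a) \<Rightarrow> ('a \<Rightarrow> 'a) \<Rightarrow> 'f free_alg set" where
  "star_C s invol = {f. \<forall>\<phi>. evaluation s invol \<phi> \<longrightarrow> \<phi> f \<in> alg_center}"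

definition star_endo :: "('f::field free_alg \<Rightarrow> 'f free_alg) \<Rightarrow> bool" where
  "star_endo \<phi> \<longleftrightarrow>
     alg_hom free_scale free_scale \<phi> \<and> (\<forall>f. \<phi> (free_star f) = free_star (\<phi> f))"

definition T_star_space :: "'f::field free_alg set \<Rightarrow> bool" where
  "T_star_space V \<longleftrightarrow>
     module.subspace free_scale V \<and> (\<forall>\<phi>. star_endo \<phi> \<longrightarrow> \<phi> ` V \<subseteq> V)"

definition TS :: "'f::field free_alg set \<Rightarrow> 'f free_alg set" where
  "TS W = T_star_space hull W"


section \<open>The algebra of upper triangular 2 by 2 matrices\<close>

typedef (overloaded) 'f ut2 = "{A :: ('f::zero)^2^2. A $ 2 $ 1 = 0}"
  morphisms mat_of_ut2 Abs_ut2
  by (rule exI[of _ 0]) simp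

setup_lifting type_definition_ut2

instantiation ut2 :: (field) ring_1
begin

lift_definition zero_ut2 :: "'a ut2" is 0 by simp
lift_definition one_ut2 :: "'a ut2" is "mat 1" by (simp add: mat_def)
lift_definition plus_ut2 :: "'a ut2 \<Rightarrow> 'a ut2 \<Rightarrow> 'a ut2" is "(+)" by simp
lift_definition minus_ut2 :: "'a ut2 \<Rightarrow> 'a ut2 \<Rightarrow> 'a ut2" is "(-)" by simp
lift_definition uminus_ut2 :: "'a ut2 \<Rightarrow> 'a ut2" is uminus by simp
lift_definition times_ut2 :: "'a ut2 \<Rightarrow> 'a ut2 \<Rightarrow> 'a ut2" is "(**)"
  by (simp add: matrix_matrix_mult_def sum_2)

instance
proof
  fix a b c :: "'a ut2"
  show "a + b + c = a + (b + c)" by transfer (simp add: add.assoc)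
  show "a + b = b + a" by transfer (simp add: add.commute)
  show "0 + a = a" by transfer simp
  show "- a + a = 0" by transfer simp
  show "a - b = a + - b" by transfer simp
  show "a * b * c = a * (b * c)" by transfer (simp add: matrix_mul_assoc)
  show "(a + b) * c = a * c + b * c"
    by transfer (simp add: matrix_matrix_mult_def vec_eq_iff sum_2 algebra_simps)
  show "a * (b + c) = a * b + a * c" by transfer (simp add: matrix_add_ldistrib)
  show "1 * a = a" by transfer simp
  show "a * 1 = a" by transfer simp
  show "(0::'a ut2) \<noteq> 1" by transfer (simp add: mat_def vec_eq_iff)
qed

end

lift_definition ut2_scale :: "'f::field \<Rightarrow> 'f ut2 \<Rightarrow> 'f ut2" is "\<lambda>c A. \<chi> i j. c * A $ i $ j"
  by simp

text \<open>\<open>ut2 a c b\<close> is the matrix with rows \<open>(a, c)\<close> and \<open>(0, b)\<close>.\<close>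

lift_definition ut2 :: "'f::field \<Rightarrow> 'f \<Rightarrow> 'f \<Rightarrow> 'f ut2"
  is "\<lambda>a c b. vector [vector [a, c], vector [0, b]]"
  by simp

lift_definition ut2_star :: "'f::field ut2 \<Rightarrow> 'f ut2"
  is "\<lambda>A. vector [vector [A $ 2 $ 2, A $ 1 $ 2], vector [0, A $ 1 $ 1]]"
  by simp

lemma ut2_star_ut2: "ut2_star (ut2 a c b) = ut2 b c a"
  by transfer simp

lemma ut2_cases: obtains a c b where "A = ut2 a c b"
proof
  show "A = ut2 (mat_of_ut2 A $ 1 $ 1) (mat_of_ut2 A $ 1 $ 2) (mat_of_ut2 A $ 2 $ 2)"
    by transfer (simp add: vec_eq_iff forall_2)
qed

lemma star_algebra_ut2: "star_algebra ut2_scale ut2_star"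
proof
  fix c d :: 'a and a b :: "'a ut2"
  show "ut2_scale c (a + b) = ut2_scale c a + ut2_scale c b"
    by transfer (simp add: vec_eq_iff algebra_simps)
  show "ut2_scale (c + d) a = ut2_scale c a + ut2_scale d a"
    by transfer (simp add: vec_eq_iff algebra_simps)
  show "ut2_scale c (ut2_scale d a) = ut2_scale (c * d) a"
    by transfer (simp add: vec_eq_iff algebra_simps)
  show "ut2_scale 1 a = a"
    by transfer (simp add: vec_eq_iff)
  show "ut2_scale c a * b = ut2_scale c (a * b)" "a * ut2_scale c b = ut2_scale c (a * b)"
    by (transfer, simp add: vec_eq_iff matrix_matrix_mult_def sum_2 algebra_simps)+
  show "ut2_star (a + b) = ut2_star a + ut2_star b"
    by transfer (simp add: vec_eq_iff forall_2)
  show "ut2_star (ut2_scale c a) = ut2_scale c (ut2_star a)"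
    by transfer (simp add: vec_eq_iff forall_2)
  show "ut2_star (a * b) = ut2_star b * ut2_star a"
    by transfer (simp add: vec_eq_iff forall_2 matrix_matrix_mult_def sum_2 algebra_simps)
  show "ut2_star (ut2_star a) = a"
    by transfer (simp add: vec_eq_iff forall_2)
qed

end

theory Submission
  imports Defs "HOL-Number_Theory.Residues"
begin

text \<open>
  A central value of \<open>f\<close> is a scalar matrix \<open>c\<close>, which is fixed by the involution. Hence the
  symmetric part \<open>s = (f + f\<^sup>*) / 2\<close> takes the same value \<open>c\<close>, and \<open>s\<^sup>q\<close> takes the value \<open>c\<^sup>q = c\<close>. So
  \<open>f - s\<^sup>q\<close> is an identity, while \<open>s\<^sup>q\<close> is the generator with \<open>l = 1\<close> at \<open>y\<^sub>1 = s\<close>, \<open>y\<^sub>2 = 1\<close>.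
  The converse inclusion holds since the central polynomials form a \<open>T(*)\<close>-space and the
  generators are central by direct computation.
\<close>

section \<open>Powers and cardinality in a finite field\<close>

lemma finite_field_power_card:
  fixes a :: "'f::{field,finite}"
  shows "a ^ CARD('f) = a"
proof (cases "a = 0")
  case False
  \<comment> \<open>Multiplication by \<open>a\<close> permutes the nonzero elements; cancelling
    their product leaves \<open>a ^ (CARD('f) - 1) = 1\<close>.\<close>
  have "(\<Prod>x\<in>UNIV-{0}. a * x) = \<Prod>(UNIV-{0::'f})"
    by (rule prod.reindex_bij_witness[of _ "\<lambda>x. x / a" "\<lambda>x. a * x"]) (use False in auto)
  moreover have "\<Prod>(UNIV-{0::'f}) \<noteq> 0" by simp
  ultimately have "a ^ (CARD('f) - 1) = 1"
    by (simp add: prod.distrib card_Diff_singleton)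
  then have "a ^ Suc (CARD('f) - 1) = a" by (simp only: power_Suc mult_1_right)
  then show ?thesis by (simp only: Suc_diff_1 zero_less_card_finite)
qed (simp add: zero_power)

lemma of_nat_card_finite_field: "of_nat CARD('f) = (0::'f::{field,finite})"
  using CHAR_dvd_CARD[where 'a = 'f] by (simp add: of_nat_eq_0_iff_char_dvd)

section \<open>Involutions, homomorphisms and evaluations\<close>

lemma (in star_algebra) invol_one: "invol 1 = 1"
  using invol_mult[of "invol 1" 1] by (simp add: invol_invol)

lemma free_star_symmetrized:
  "free_star (free_scale c (f + free_star f)) = free_scale c (f + free_star f)"
proof -
  interpret star_algebra "free_scale :: 'a \<Rightarrow> _" free_star by (rule star_algebra_free)
  show ?thesis by (simp add: invol_add invol_scale invol_invol add.commute)
qed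

lemma alg_hom_comp: "alg_hom s t \<phi> \<Longrightarrow> alg_hom t u \<psi> \<Longrightarrow> alg_hom s u (\<psi> \<circ> \<phi>)"
  by (auto simp: alg_hom_def intro: Vector_Spaces.linear_compose)

lemma alg_hom_power:
  assumes "alg_hom s t \<phi>"
  shows "\<phi> (a ^ n) = \<phi> a ^ n"
  using assms by (induction n) (simp_all add: alg_hom_def)

lemma alg_hom_linear:
  assumes "alg_hom s t \<phi>"
  shows "\<phi> (a + b) = \<phi> a + \<phi> b" "\<phi> (a - b) = \<phi> a - \<phi> b" "\<phi> (s c a) = t c (\<phi> a)" "\<phi> 0 = 0"
proof -
  interpret Vector_Spaces.linear s t \<phi> using assms by (simp add: alg_hom_def)
  show "\<phi> (a + b) = \<phi> a + \<phi> b" "\<phi> (a - b) = \<phi> a - \<phi> b" "\<phi> (s c a) = t c (\<phi> a)" "\<phi> 0 = 0"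
    by (simp_all add: add diff scale)
qed

text \<open>Conjugating \<open>\<phi>\<close> by the two involutions reverses products twice, so it
  gives a homomorphism again. It agrees with \<open>\<phi>\<close> on every \<open>gen_y i\<close>
  and \<open>gen_z i\<close>, because both signs match, and freeness makes the two equal.\<close>

lemma evaluation_star:
  fixes s :: "'f::field \<Rightarrow> 'a::ring_1 \<Rightarrow> 'a"
  assumes "star_algebra s invol" and char: "CHAR('f) \<noteq> 2" and ev: "evaluation s invol \<phi>"
  shows "\<phi> (free_star f) = invol (\<phi> f)"
proof -
  interpret A: star_algebra s invol by fact
  interpret F: star_algebra "free_scale :: 'f \<Rightarrow> _" free_star by (rule star_algebra_free)
  define \<psi> where "\<psi> f = invol (\<phi> (free_star f))" for f
  have hom: "alg_hom free_scale s \<phi>"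
    and y: "invol (\<phi> (gen_y i)) = \<phi> (gen_y i)" and z: "invol (\<phi> (gen_z i)) = - \<phi> (gen_z i)" for i
    using ev by (auto simp: evaluation_def symmetric_elems_def skew_elems_def)
  note lin = alg_hom_linear[OF hom]
  have neg: "\<phi> (- g) = - \<phi> g" "invol (- u) = - invol u" for g u
    using lin(2)[of 0 g] lin(4) A.invol_scale[of "-1" u] by auto
  have "Vector_Spaces.linear free_scale s \<psi>"
    by unfold_locales
      (simp_all add: \<psi>_def F.invol_add F.invol_scale A.invol_add A.invol_scale lin)
  then have "alg_hom free_scale s \<psi>"
    using hom by (simp add: alg_hom_def \<psi>_def F.invol_mult A.invol_mult A.invol_one F.invol_one)
  moreover have "\<psi> (gen_y i) = \<phi> (gen_y i)" "\<psi> (gen_z i) = \<phi> (gen_z i)" for i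
    by (simp_all add: \<psi>_def free_star_gen_y free_star_gen_z neg y z)
  ultimately have "\<psi> = \<phi>"
    using free_on_y_z[OF A.assoc_algebra_axioms char, of "\<lambda>i. \<phi> (gen_y i)" "\<lambda>i. \<phi> (gen_z i)"] hom
    by blast
  then show ?thesis using A.invol_invol by (metis \<psi>_def)
qed

text \<open>Both maps respect the involutions, so the images of the generators stay symmetric or
  skew. This yields closure of central polynomials under \<open>star_endo\<close>.\<close>

lemma evaluation_comp_star_endo:
  assumes "star_algebra s invol" and "CHAR('f::field) \<noteq> 2"
    and ev: "evaluation (s :: 'f \<Rightarrow> 'a::ring_1 \<Rightarrow> 'a) invol \<phi>" and endo: "star_endo \<theta>"
  shows "evaluation s invol (\<phi> \<circ> \<theta>)"
proof -
  have hom: "alg_hom free_scale s \<phi>" "alg_hom free_scale free_scale \<theta>"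
    using ev endo by (auto simp: evaluation_def star_endo_def)
  have neg: "\<theta> (- a) = - \<theta> a" "\<phi> (- b) = - \<phi> b" for a b
    using alg_hom_linear(2,4)[OF hom(1)] alg_hom_linear(2,4)[OF hom(2)]
    by (metis diff_0)+
  have "invol (\<phi> (\<theta> f)) = \<phi> (\<theta> (free_star f))" for f
    using endo by (simp add: star_endo_def evaluation_star[OF assms(1,2) ev])
  then show ?thesis
    using alg_hom_comp[OF hom(2,1)]
    by (simp add: evaluation_def symmetric_elems_def skew_elems_def free_star_gen_y
        free_star_gen_z neg)
qed

text \<open>The homomorphism given by freeness is an evaluation of the free algebra in itself, so
  \<open>evaluation_star\<close> applies to it and shows that it commutes with
  \<open>free_star\<close>.\<close>

lemma star_endo_exists:
  fixes a b :: "nat \<Rightarrow> 'f::field free_alg"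
  assumes "CHAR('f) \<noteq> 2"
    and "\<And>i. free_star (a i) = a i" and "\<And>i. free_star (b i) = - b i"
  obtains \<theta> where "star_endo \<theta>" "\<And>i. \<theta> (gen_y i) = a i" "\<And>i. \<theta> (gen_z i) = b i"
proof -
  obtain \<theta> where \<theta>: "alg_hom free_scale free_scale \<theta>" "\<And>i. \<theta> (gen_y i) = a i" "\<And>i. \<theta> (gen_z i) = b i"
    using free_on_y_z[OF assoc_algebra_free assms(1), of a b] by blast
  then have "evaluation free_scale free_star \<theta>"
    using assms(2,3) by (simp add: evaluation_def symmetric_elems_def skew_elems_def)
  then have "star_endo \<theta>"
    using evaluation_star[OF star_algebra_free assms(1)] \<theta>(1) by (simp add: star_endo_def)
  with \<theta> that show thesis by blast
qed

section \<open>Central polynomials and T-star spaces\<close>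

lemma star_CD: "f \<in> star_C s invol \<Longrightarrow> evaluation s invol \<phi> \<Longrightarrow> \<phi> f \<in> alg_center"
  unfolding star_C_def mem_Collect_eq by (drule spec[of _ \<phi>], drule (1) mp)

lemma star_IdD: "f \<in> star_Id s invol \<Longrightarrow> evaluation s invol \<phi> \<Longrightarrow> \<phi> f = 0"
  unfolding star_Id_def mem_Collect_eq by (drule spec[of _ \<phi>], drule (1) mp)

lemma T_star_spaceI:
  assumes "module.subspace free_scale V" and "\<And>\<theta> f. star_endo \<theta> \<Longrightarrow> f \<in> V \<Longrightarrow> \<theta> f \<in> V"
  shows "T_star_space V"
  unfolding T_star_space_def
proof (intro conjI allI impI subsetI)
  fix \<theta> g assume \<theta>: "star_endo \<theta>" and g: "g \<in> \<theta> ` V"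
  from g obtain f where "g = \<theta> f" "f \<in> V" by (rule imageE)
  then show "g \<in> V" using assms(2)[OF \<theta>, of f] by simp
qed (rule assms(1))

lemma T_star_spaceD:
  assumes "T_star_space V"
  shows "module.subspace free_scale V" and "star_endo \<theta> \<Longrightarrow> f \<in> V \<Longrightarrow> \<theta> f \<in> V"
proof -
  show "module.subspace free_scale V"
    using assms unfolding T_star_space_def by (rule conjunct1)
  assume \<theta>: "star_endo \<theta>" and f: "f \<in> V"
  have "\<forall>\<theta>. star_endo \<theta> \<longrightarrow> \<theta> ` V \<subseteq> V"
    using assms unfolding T_star_space_def by (rule conjunct2)
  from mp[OF spec[OF this] \<theta>] show "\<theta> f \<in> V" using f by (rule subsetD[OF _ imageI])
qed

lemma T_star_space_star_C:
  fixes s :: "'f::field \<Rightarrow> 'a::ring_1 \<Rightarrow> 'a"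
  assumes "star_algebra s invol" and "CHAR('f) \<noteq> 2"
  shows "T_star_space (star_C s invol)"
proof -
  interpret A: star_algebra s invol by fact
  interpret F: star_algebra "free_scale :: 'f \<Rightarrow> _" free_star by (rule star_algebra_free)
  show ?thesis
  proof (rule T_star_spaceI)
    show "module.subspace free_scale (star_C s invol)"
    proof (rule F.subspaceI)
      fix c f g assume f: "f \<in> star_C s invol"
      show "free_scale c f \<in> star_C s invol"
        unfolding star_C_def
      proof clarify
        fix \<phi> assume ev: "evaluation s invol \<phi>"
        then have "alg_hom free_scale s \<phi>" by (simp add: evaluation_def)
        from alg_hom_linear(3)[OF this, of c f] star_CD[OF f ev] show "\<phi> (free_scale c f) \<in> alg_center"
          by (simp add: alg_center_def A.scale_mult_left A.scale_mult_right)
      qed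
      assume g: "g \<in> star_C s invol"
      show "f + g \<in> star_C s invol"
        unfolding star_C_def
      proof clarify
        fix \<phi> assume ev: "evaluation s invol \<phi>"
        then have "alg_hom free_scale s \<phi>" by (simp add: evaluation_def)
        from alg_hom_linear(1)[OF this, of f g] star_CD[OF f ev] star_CD[OF g ev]
        show "\<phi> (f + g) \<in> alg_center"
          by (simp add: alg_center_def distrib_left distrib_right)
      qed
    next
      show "0 \<in> star_C s invol"
        unfolding star_C_def
      proof clarify
        fix \<phi> assume "evaluation s invol \<phi>"
        then have "alg_hom free_scale s \<phi>" by (simp add: evaluation_def)
        from alg_hom_linear(4)[OF this] show "\<phi> 0 \<in> alg_center"
          by (simp add: alg_center_def)
      qed
    qed
    show "\<theta> f \<in> star_C s invol" if "star_endo \<theta>" "f \<in> star_C s invol" for \<theta> f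
      unfolding star_C_def
    proof clarify
      fix \<phi> assume ev: "evaluation s invol \<phi>"
      from star_CD[OF that(2) evaluation_comp_star_endo[OF assms ev that(1)]]
      show "\<phi> (\<theta> f) \<in> alg_center" by simp
    qed
  qed
qed

text \<open>A hull is an intersection, and it has the defining property only because that property
  is stable under intersections.\<close>

lemma T_star_space_TS:
  fixes W :: "'f::field free_alg set"
  shows "T_star_space (TS W)"
proof -
  interpret F: star_algebra "free_scale :: 'f \<Rightarrow> _" free_star by (rule star_algebra_free)
  have "T_star_space (\<Inter>\<V>)" if "Ball \<V> T_star_space" for \<V> :: "'f free_alg set set"
  proof (rule T_star_spaceI)
    note TV = bspec[OF that]
    show "F.subspace (\<Inter>\<V>)"
      by (intro F.subspace_Inter ballI T_star_spaceD(1) TV)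
    show "\<theta> f \<in> \<Inter>\<V>" if "star_endo \<theta>" "f \<in> \<Inter>\<V>" for \<theta> f
      by (rule InterI) (rule T_star_spaceD(2)[OF TV that(1) InterD[OF that(2)]])
  qed
  then show ?thesis
    unfolding TS_def by (rule hull_in[where S = T_star_space])
qed

section \<open>Arithmetic, symmetric and skew elements, and the center of UT_2\<close>

lemma ut2_inject [simp]: "ut2 a c b = ut2 a' c' b' \<longleftrightarrow> a = a' \<and> c = c' \<and> b = b'"
  by transfer (auto simp: vec_eq_iff forall_2)

lemma ut2_arith:
  "ut2 a c b * ut2 a' c' b' = ut2 (a * a') (a * c' + c * b') (b * b')"
  "ut2 a c b + ut2 a' c' b' = ut2 (a + a') (c + c') (b + b')"
  "ut2 a c b - ut2 a' c' b' = ut2 (a - a') (c - c') (b - b')"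
  "- ut2 a c b = ut2 (- a) (- c) (- b)"
  "ut2_scale k (ut2 a c b) = ut2 (k * a) (k * c) (k * b)"
  by (transfer, simp add: vec_eq_iff forall_2 matrix_matrix_mult_def sum_2)+

lemma ut2_0_1: "0 = ut2 0 0 0" "1 = ut2 1 0 1"
  by (transfer, simp add: vec_eq_iff forall_2 mat_def)+

lemma ut2_symmetric:
  assumes "A \<in> symmetric_elems ut2_star"
  obtains a c where "A = ut2 a c a"
proof (cases A rule: ut2_cases)
  case (1 a c b)
  have "ut2 b c a = ut2 a c b"
    using assms unfolding 1 symmetric_elems_def mem_Collect_eq ut2_star_ut2 .
  then have "b = a" unfolding ut2_inject by iprover
  show thesis by (rule that[of a c]) (simp only: 1 \<open>b = a\<close>)
qed

lemma ut2_skew: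
  assumes "A \<in> skew_elems (ut2_star :: 'f::field ut2 \<Rightarrow> _)" and char: "CHAR('f) \<noteq> 2"
  obtains b where "A = ut2 b 0 (- b)"
proof (cases A rule: ut2_cases)
  case (1 a c b)
  have "ut2 b c a = ut2 (- a) (- c) (- b)"
    using assms(1) unfolding 1 skew_elems_def mem_Collect_eq ut2_star_ut2 ut2_arith .
  then have b: "b = - a" and "c = - c" unfolding ut2_inject by iprover+
  from this(2) have "2 * c = 0" unfolding mult_2 by (rule eq_neg_iff_add_eq_0[THEN iffD1])
  then have "c = 0" using two_neq_zero[OF char] by simp
  show thesis by (rule that[of a]) (simp only: 1 b \<open>c = 0\<close>)
qed

text \<open>The matrix is a scalar plus a square-zero part, so the corner entry is \<open>c\<close>
  times the derivative of the n-th power at \<open>a\<close>. For \<open>n = 0\<close> the truncated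
  exponent is harmless, since the coefficient \<open>of_nat n\<close> vanishes.\<close>

lemma ut2_power: "ut2 a c a ^ n = ut2 (a ^ n) (of_nat n * a ^ (n - 1) * c) (a ^ n)"
proof (induction n)
  case (Suc n)
  then show ?case by (cases n) (simp_all add: ut2_arith algebra_simps)
qed (simp add: ut2_0_1)

lemma ut2_center_iff: "A \<in> alg_center \<longleftrightarrow> (\<exists>a. A = ut2 a 0 a)"
proof (cases A rule: ut2_cases)
  case (1 a c b)
  show ?thesis
  proof
    assume "A \<in> alg_center"
    \<comment> \<open>Commuting with the first matrix unit forces \<open>c = 0\<close>, with the
      second \<open>a = b\<close>.\<close>
    then have "A * ut2 1 0 0 = ut2 1 0 0 * A" "A * ut2 0 1 0 = ut2 0 1 0 * A"
      by (auto simp: alg_center_def)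
    then show "\<exists>a. A = ut2 a 0 a" by (simp add: 1 ut2_arith)
  next
    assume "\<exists>a. A = ut2 a 0 a"
    then have "A * B = B * A" for B
      by (cases B rule: ut2_cases) (auto simp: ut2_arith mult.commute)
    then show "A \<in> alg_center" by (simp add: alg_center_def)
  qed
qed

text \<open>The two powers of \<open>B\<close> share their diagonal, so their difference has only
  the corner entry \<open>- (b ^ (l - 1) * d)\<close>. The first summand thus has corner
  \<open>- (l * a * b ^ (l - 1) * d)\<close>. As \<open>A ^ q\<close> is the scalar
  \<open>a\<close>, the second summand has the opposite corner.\<close>

lemma generator_central:
  fixes A B :: "'f::{field,finite} ut2"
  assumes A: "A \<in> symmetric_elems ut2_star" and B: "B \<in> symmetric_elems ut2_star"
    and q: "q = CARD('f)" and l: "1 \<le> l"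
  shows "ut2_scale (of_nat l) (A * (B ^ (q + l - 1) - B ^ l)) + A ^ q * B ^ l \<in> alg_center"
proof -
  obtain a c where Aeq: "A = ut2 a c a" using A by (rule ut2_symmetric)
  obtain b d where Beq: "B = ut2 b d b" using B by (rule ut2_symmetric)
  \<comment> \<open>This removes truncated subtraction: \<open>q + l - 1\<close> becomes
    \<open>q + k\<close>, and \<open>l - 1\<close> becomes \<open>k\<close>.\<close>
  obtain k where k: "l = Suc k" using l by (cases l) auto
  have q0: "of_nat q = (0::'f)" and pow: "x ^ q = x" for x :: 'f
    by (simp_all add: q of_nat_card_finite_field finite_field_power_card)
  have Bq: "B ^ (q + k) = ut2 (b ^ Suc k) (of_nat k * b ^ k * d) (b ^ Suc k)"
  proof -
    \<comment> \<open>For \<open>k = 0\<close> both sides vanish as \<open>of_nat q = 0\<close>;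
      otherwise \<open>b ^ q = b\<close> absorbs the shift of the exponent.\<close>
    have "of_nat (q + k) * b ^ (q + k - 1) = of_nat k * b ^ k"
      by (cases k) (simp_all add: q0 pow power_add)
    moreover have "b ^ (q + k) = b ^ Suc k" by (simp add: power_add pow)
    ultimately show ?thesis by (simp only: Beq ut2_power)
  qed
  have "A ^ q = ut2 a 0 a" by (simp add: Aeq ut2_power q0 pow)
  moreover have "B ^ l = ut2 (b ^ Suc k) (of_nat (Suc k) * b ^ k * d) (b ^ Suc k)"
    by (simp only: Beq ut2_power k diff_Suc_1)
  ultimately show ?thesis
    using Bq by (simp add: k Aeq ut2_arith ut2_center_iff algebra_simps)
qed

section \<open>The two inclusions between the central polynomials and the sum\<close>

theorem theorem4p20:
  fixes q p :: nat
  assumes q: "CARD('f::{field,finite}) = q"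
    and p: "CHAR('f) = p"
    and odd_char: "p \<noteq> 2"
  shows "star_C (ut2_scale :: 'f \<Rightarrow> 'f ut2 \<Rightarrow> 'f ut2) ut2_star =
    TS {free_scale (of_nat l) (gen_y 1 * (gen_y 2 ^ (q + l - 1) - gen_y 2 ^ l))
          + gen_y 1 ^ q * gen_y 2 ^ l | l. 1 \<le> l \<and> l \<le> p}
    + TS {gen_z 1 * gen_z 2}
    + star_Id ut2_scale ut2_star"
    (is "?C = TS ?G + TS ?Z + ?I")
proof
  interpret F: star_algebra "free_scale :: 'f \<Rightarrow> _" free_star by (rule star_algebra_free)
  have char: "CHAR('f) \<noteq> 2" using p odd_char by simp
  have TC: "T_star_space ?C" by (rule T_star_space_star_C[OF star_algebra_ut2 char])
  then have subC: "F.subspace ?C" by (rule T_star_spaceD(1))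
  show "?C \<subseteq> TS ?G + TS ?Z + ?I"
  proof
    fix f assume f: "f \<in> ?C"
    define s where "s = free_scale (1/2) (f + free_star f)"
    \<comment> \<open>With \<open>gen_y 2\<close> sent to 1, the difference of powers in the
      generator disappears and only \<open>s ^ q\<close> survives.\<close>
    define a where "a i = (if i = (1::nat) then s else 1)" for i
    have "free_star (a i) = a i" for i
      by (simp add: a_def s_def free_star_symmetrized F.invol_one)
    moreover have "free_star (0 :: 'f free_alg) = - 0" by simp
    ultimately obtain \<theta> where \<theta>: "star_endo \<theta>" "\<And>i. \<theta> (gen_y i) = a i"
      "\<And>i. \<theta> (gen_z i) = 0"
      by (rule star_endo_exists[OF char, of a "\<lambda>_. 0"]) (rule that)
    have hom\<theta>: "alg_hom free_scale free_scale \<theta>" using \<theta>(1) by (simp add: star_endo_def)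
    \<comment> \<open>A finite field has positive characteristic, so \<open>l = 1\<close> is an
      admissible index.\<close>
    have "p \<ge> 1" using finite_imp_CHAR_pos[where 'a = 'f] p by simp
    then have "free_scale (of_nat 1) (gen_y 1 * (gen_y 2 ^ (q + 1 - 1) - gen_y 2 ^ 1))
          + gen_y 1 ^ q * gen_y 2 ^ 1 \<in> ?G" (is "?g \<in> _")
      by (intro CollectI exI[of _ 1] conjI refl order.refl)
    then have "?g \<in> TS ?G" unfolding TS_def by (rule hull_inc)
    then have "\<theta> ?g \<in> TS ?G"
      by (rule T_star_spaceD(2)[OF T_star_space_TS \<theta>(1)])
    moreover have "\<theta> ?g = s ^ q"
      using hom\<theta> by (simp add: alg_hom_linear[OF hom\<theta>] alg_hom_power[OF hom\<theta>] \<theta>(2) a_def alg_hom_def)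
    ultimately have s: "s ^ q \<in> TS ?G" by simp
    have "f - s ^ q \<in> ?I"
      unfolding star_Id_def
    proof clarify
      fix \<phi> assume ev: "evaluation (ut2_scale :: 'f \<Rightarrow> _) ut2_star \<phi>"
      then have hom: "alg_hom free_scale ut2_scale \<phi>" by (simp add: evaluation_def)
      obtain a where a: "\<phi> f = ut2 a 0 a"
        using star_CD[OF f ev] unfolding ut2_center_iff by (elim exE)
      have "\<phi> s = ut2 a 0 a"
        using two_neq_zero[OF char]
        by (simp add: s_def alg_hom_linear[OF hom] evaluation_star[OF star_algebra_ut2 char ev]
            a ut2_star_ut2 ut2_arith field_simps)
      then show "\<phi> (f - s ^ q) = 0"
        by (simp add: alg_hom_linear[OF hom] alg_hom_power[OF hom] a ut2_power ut2_arith ut2_0_1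
            finite_field_power_card flip: q)
    qed
    \<comment> \<open>The zero polynomial is taken as the summand from \<open>TS ?Z\<close>.\<close>
    then have "s ^ q + 0 + (f - s ^ q) \<in> TS ?G + TS ?Z + ?I"
    proof (intro set_plus_intro s)
      show "0 \<in> TS ?Z"
        by (rule F.subspace_0[OF T_star_spaceD(1)[OF T_star_space_TS]])
    qed
    then show "f \<in> TS ?G + TS ?Z + ?I" by simp
  qed
  \<comment> \<open>Since \<open>?C\<close> is a T-star space, minimality of the hull reduces the
    inclusions of \<open>TS ?G\<close> and \<open>TS ?Z\<close> to their generators.\<close>
  have "?G \<subseteq> ?C"
  proof (clarsimp simp: star_C_def)
    fix l \<phi> assume l: "Suc 0 \<le> l" and ev: "evaluation (ut2_scale :: 'f \<Rightarrow> _) ut2_star \<phi>"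
    then have hom: "alg_hom free_scale ut2_scale \<phi>" by (simp add: evaluation_def)
    then have mult: "\<phi> (u * v) = \<phi> u * \<phi> v" for u v by (simp add: alg_hom_def)
    show "\<phi> (free_scale (of_nat l) (gen_y (Suc 0) * (gen_y 2 ^ (q + l - Suc 0) - gen_y 2 ^ l))
          + gen_y (Suc 0) ^ q * gen_y 2 ^ l) \<in> alg_center"
      using generator_central[of "\<phi> (gen_y (Suc 0))" "\<phi> (gen_y 2)" q l] ev l q
      by (simp add: alg_hom_linear[OF hom] alg_hom_power[OF hom] mult evaluation_def)
  qed
  then have G: "TS ?G \<subseteq> ?C" unfolding TS_def using TC by (rule hull_minimal)
  have "?Z \<subseteq> ?C"
  proof (clarsimp simp: star_C_def)
    fix \<phi> assume ev: "evaluation (ut2_scale :: 'f \<Rightarrow> _) ut2_star \<phi>"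
    then have z: "\<phi> (gen_z i) \<in> skew_elems ut2_star" for i by (simp add: evaluation_def)
    obtain b where "\<phi> (gen_z (Suc 0)) = ut2 b 0 (- b)" using z char by (rule ut2_skew)
    moreover obtain b' where "\<phi> (gen_z 2) = ut2 b' 0 (- b')" using z char by (rule ut2_skew)
    \<comment> \<open>The two sign changes cancel, so both diagonal entries of the product are
      \<open>b * b'\<close>.\<close>
    ultimately show "\<phi> (gen_z (Suc 0) * gen_z 2) \<in> alg_center"
      using ev by (simp add: evaluation_def alg_hom_def ut2_arith ut2_center_iff)
  qed
  then have Z: "TS ?Z \<subseteq> ?C" unfolding TS_def using TC by (rule hull_minimal)
  have I: "?I \<subseteq> ?C"
  proof
    fix f assume f: "f \<in> ?I"
    show "f \<in> ?C"
      unfolding star_C_def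
    proof clarify
      fix \<phi> assume "evaluation (ut2_scale :: 'f \<Rightarrow> _) ut2_star \<phi>"
      from star_IdD[OF f this] show "\<phi> f \<in> alg_center" by (simp add: alg_center_def)
    qed
  qed
  show "TS ?G + TS ?Z + ?I \<subseteq> ?C"
  proof
    fix f assume "f \<in> TS ?G + TS ?Z + ?I"
    then obtain u v w where "u \<in> TS ?G" "v \<in> TS ?Z" "w \<in> ?I" "f = u + v + w"
      by (elim set_plus_elim) blast
    moreover from this have "u \<in> ?C" "v \<in> ?C" "w \<in> ?C"
      using G Z I by (auto dest: subsetD)
    ultimately show "f \<in> ?C" by (simp only: F.subspace_add[OF subC])
  qed
qed

end
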